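(* Let $\mathcal{R}$ be an $R$-variety, let $M$ be an $\mathcal{R}$-monoid and let $x\in M$. Then $M\setminus\{x\}$ is an $\mathcal{R}$-monoid if and only if $x$ belongs to the minimal $\mathcal{R}$-system of generators of $M$.
   Context: Let $\mathbb{N}$ be the set of nonnegative integers. A numerical semigroup is a subset $S\subseteq\mathbb{N}$ that is closed under addition, contains $0$, and has $\mathbb{N}\setminus S$ finite. If $S\subsetneq T$ are numerical semigroups, $\mathrm{F}_T(S)=\max(T\setminus S)$. An $R$-variety is a non-empty family $\mathcal{R}$ of numerical semigroups such that: (1) $\mathcal{R}$ has a maximum element with respect to inclusion, denoted $\Delta(\mathcal{R})$; (2) if $S,T\in\mathcal{R}$ then $S\cap T\in\mathcal{R}$; (3) if $S\in\mathcal{R}$ and $S\neq\Delta(\mathcal{R})$ then $S\cup\{\mathrm{F}_{\Delta(\mathcal{R})}(S)\}\in\mathcal{R}$. An $\mathcal{R}$-monoid is a submonoid of $(\mathbb{N},+)$ that is the intersection of a (non-empty, possibly infinite) family of elements of $\mathcal{R}$. For $A\subseteq\Delta(\mathcal{R})$, $\mathcal{R}(A)$ denotes the $\mathcal{R}$-monoid generated by $A$: the intersection of all $\mathcal{R}$-monoids containing $A$. If $M=\mathcal{R}(A)$, then $A$ is an $\mathcal{R}$-system of generators of $M$; it is a minimal $\mathcal{R}$-system of generators of $M$ if moreover $M\neq\mathcal{R}(B)$ for all $B\subsetneq A$. Every $\mathcal{R}$-monoid has a unique minimal $\mathcal{R}$-system of generators. *)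

theory Defs
  imports Main
begin

definition is_submonoid :: "nat set \<Rightarrow> bool" where
  "is_submonoid M \<longleftrightarrow> 0 \<in> M \<and> (\<forall>a\<in>M. \<forall>b\<in>M. a + b \<in> M)"

definition numerical_semigroup :: "nat set \<Rightarrow> bool" where
  "numerical_semigroup S \<longleftrightarrow> is_submonoid S \<and> finite (UNIV - S)"

(* Meaningful only if T - S is finite and non-empty, as for numerical semigroups S \<subset> T. *)
definition relative_frobenius :: "nat set \<Rightarrow> nat set \<Rightarrow> nat" where
  "relative_frobenius T S = Max (T - S)"

(* The order on sets is inclusion; meaningful only if \<R> has a maximum element. *)
definition maximum_member :: "nat set set \<Rightarrow> nat set" where
  "maximum_member \<R> = (GREATEST S. S \<in> \<R>)"

definition R_variety :: "nat set set \<Rightarrow> bool" where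
  "R_variety \<R> \<longleftrightarrow>
     \<R> \<noteq> {} \<and>
     (\<forall>S\<in>\<R>. numerical_semigroup S) \<and>
     (\<exists>D\<in>\<R>. \<forall>S\<in>\<R>. S \<subseteq> D) \<and>
     (\<forall>S\<in>\<R>. \<forall>T\<in>\<R>. S \<inter> T \<in> \<R>) \<and>
     (\<forall>S\<in>\<R>. S \<noteq> maximum_member \<R> \<longrightarrow>
        S \<union> {relative_frobenius (maximum_member \<R>) S} \<in> \<R>)"

definition R_monoid :: "nat set set \<Rightarrow> nat set \<Rightarrow> bool" where
  "R_monoid \<R> M \<longleftrightarrow>
     is_submonoid M \<and> (\<exists>\<F>. \<F> \<noteq> {} \<and> \<F> \<subseteq> \<R> \<and> M = \<Inter>\<F>)"

(* For A \<subseteq> maximum_member \<R> the family is non-empty: it contains maximum_member \<R>. *)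
definition R_generated :: "nat set set \<Rightarrow> nat set \<Rightarrow> nat set" where
  "R_generated \<R> A = \<Inter>{M. R_monoid \<R> M \<and> A \<subseteq> M}"

definition R_system_of_generators :: "nat set set \<Rightarrow> nat set \<Rightarrow> nat set \<Rightarrow> bool" where
  "R_system_of_generators \<R> M A \<longleftrightarrow> A \<subseteq> maximum_member \<R> \<and> M = R_generated \<R> A"

definition is_minimal_R_system :: "nat set set \<Rightarrow> nat set \<Rightarrow> nat set \<Rightarrow> bool" where
  "is_minimal_R_system \<R> M A \<longleftrightarrow>
     R_system_of_generators \<R> M A \<and> (\<forall>B. B \<subset> A \<longrightarrow> M \<noteq> R_generated \<R> B)"

(* Well defined when \<R> is an R-variety and M is an R-monoid of it: such an M has
   exactly one minimal R-system of generators. *)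
definition minimal_R_system :: "nat set set \<Rightarrow> nat set \<Rightarrow> nat set" where
  "minimal_R_system \<R> M = (THE A. is_minimal_R_system \<R> M A)"

end

theory Submission
  imports Defs
begin

text \<open>
  Everything rests on one closure property of an R-variety with maximum \<open>\<Delta>\<close>: adding relative
  Frobenius numbers to a member \<open>S\<close> fills the gaps \<open>\<Delta> - S\<close> from the top down, so for every bound
  \<open>x\<close> the set \<open>S \<union> {d \<in> \<Delta>. x < d}\<close> is again a member (\<open>R_variety_fill_above\<close>).  Hence whether
  \<open>x\<close> is generated by \<open>A\<close> depends only on the elements of \<open>A\<close> up to \<open>x\<close>: a member that contains
  those elements and avoids \<open>x\<close> can be enlarged above \<open>x\<close> until it contains all of \<open>A\<close>
  (\<open>R_generated_below\<close>).

  Consequently the generators of an R-monoid \<open>M\<close> can be found greedily from below.  Call \<open>x \<in> M\<close>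
  indispensable if the smaller elements of \<open>M\<close> do not generate it.  By strong induction the
  indispensable elements generate \<open>M\<close>, and by locality every system of generators contains all of
  them; so they form the unique minimal system of generators (\<open>minimal_R_system_eq\<close>).

  It remains to see that \<open>x\<close> is indispensable exactly if \<open>M - {x}\<close> is an R-monoid.  If it is one,
  it contains the smaller elements of \<open>M\<close> but not \<open>x\<close>.  Conversely, a member that contains the
  smaller elements and avoids \<open>x\<close>, enlarged above \<open>x\<close>, cuts out of \<open>M\<close> exactly \<open>M - {x}\<close>.
\<close>

lemma member_subset_maximum_member:
  assumes "R_variety \<R>" and "S \<in> \<R>"
  shows "S \<subseteq> maximum_member \<R>"
proof -
  obtain D where D: "D \<in> \<R>" "\<forall>S\<in>\<R>. S \<subseteq> D"
    using assms(1) unfolding R_variety_def by blast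
  then have "maximum_member \<R> = D"
    unfolding maximum_member_def by (intro Greatest_equality) auto
  with D assms(2) show ?thesis by auto
qed

text \<open>
  As long as \<open>S\<close> misses an element of the maximum above \<open>x\<close>, its relative Frobenius number is above
  \<open>x\<close> too.  Adding it leaves the target set unchanged and shrinks the finite set of gaps.
\<close>

lemma R_variety_fill_above:
  assumes R: "R_variety \<R>" and "S \<in> \<R>"
  shows "S \<union> {d \<in> maximum_member \<R>. x < d} \<in> \<R>"
  using \<open>S \<in> \<R>\<close>
proof (induction "card (maximum_member \<R> - S)" arbitrary: S rule: less_induct)
  case less
  let ?D = "maximum_member \<R>"
  show ?case
  proof (cases "{d \<in> ?D. x < d} \<subseteq> S")
    case True
    then have "S \<union> {d \<in> ?D. x < d} = S" by blast
    with less.prems show ?thesis by simp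
  next
    case False
    then obtain d where d: "d \<in> ?D - S" "x < d" by blast
    define F where "F = relative_frobenius ?D S"
    have "finite (UNIV - S)"
      using R less.prems unfolding R_variety_def numerical_semigroup_def by blast
    then have fin: "finite (?D - S)"
      by (rule rev_finite_subset) blast
    have F: "F \<in> ?D - S"
      using fin d(1) unfolding F_def relative_frobenius_def by (intro Max_in) auto
    have "d \<le> F"
      using fin d(1) unfolding F_def relative_frobenius_def by simp
    with d(2) have "x < F" by simp
    have "S \<noteq> ?D" using d(1) by blast
    then have step: "S \<union> {F} \<in> \<R>"
      using R less.prems unfolding R_variety_def F_def by blast
    have "card (?D - (S \<union> {F})) < card (?D - S)"
      using F by (intro psubset_card_mono[OF fin]) blast
    from less.hyps[OF this step] have "(S \<union> {F}) \<union> {d \<in> ?D. x < d} \<in> \<R>" .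
    moreover have "(S \<union> {F}) \<union> {d \<in> ?D. x < d} = S \<union> {d \<in> ?D. x < d}"
      using F \<open>x < F\<close> by blast
    ultimately show ?thesis by simp
  qed
qed

lemma R_monoid_Inter:
  assumes "R_variety \<R>" and "\<F> \<noteq> {}" and "\<F> \<subseteq> \<R>"
  shows "R_monoid \<R> (\<Inter>\<F>)"
proof -
  have "\<forall>S\<in>\<F>. is_submonoid S"
    using assms unfolding R_variety_def numerical_semigroup_def by blast
  then have "is_submonoid (\<Inter>\<F>)"
    unfolding is_submonoid_def by blast
  with assms(2,3) show ?thesis
    unfolding R_monoid_def by blast
qed

lemma R_monoid_member: "R_variety \<R> \<Longrightarrow> S \<in> \<R> \<Longrightarrow> R_monoid \<R> S"
  using R_monoid_Inter[of \<R> "{S}"] by simp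

lemma R_monoid_subset_maximum:
  assumes "R_variety \<R>" and "R_monoid \<R> M"
  shows "M \<subseteq> maximum_member \<R>"
proof -
  obtain S where "S \<in> \<R>" "M \<subseteq> S"
    using assms(2) unfolding R_monoid_def by blast
  with member_subset_maximum_member[OF assms(1)] show ?thesis by blast
qed

lemma R_generated_subset: "R_monoid \<R> M \<Longrightarrow> A \<subseteq> M \<Longrightarrow> R_generated \<R> A \<subseteq> M"
  unfolding R_generated_def by blast

lemma subset_R_generated: "A \<subseteq> R_generated \<R> A"
  unfolding R_generated_def by blast

lemma R_generated_mono: "A \<subseteq> B \<Longrightarrow> R_generated \<R> A \<subseteq> R_generated \<R> B"
  unfolding R_generated_def by blast

lemma R_generated_subset_R_generated:
  "A \<subseteq> R_generated \<R> B \<Longrightarrow> R_generated \<R> A \<subseteq> R_generated \<R> B"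
  unfolding R_generated_def by blast

text \<open>
  A single member of the variety, rather than an infinite intersection, witnesses that an element
  is not generated.
\<close>

lemma not_in_R_generated_iff:
  assumes "R_variety \<R>"
  shows "x \<notin> R_generated \<R> A \<longleftrightarrow> (\<exists>S\<in>\<R>. A \<subseteq> S \<and> x \<notin> S)"
proof
  assume "x \<notin> R_generated \<R> A"
  then obtain M where M: "R_monoid \<R> M" "A \<subseteq> M" "x \<notin> M"
    unfolding R_generated_def by blast
  then obtain \<F> where "\<F> \<subseteq> \<R>" "M = \<Inter>\<F>"
    unfolding R_monoid_def by blast
  with M show "\<exists>S\<in>\<R>. A \<subseteq> S \<and> x \<notin> S" by blast
next
  assume "\<exists>S\<in>\<R>. A \<subseteq> S \<and> x \<notin> S"
  then show "x \<notin> R_generated \<R> A"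
    using R_monoid_member[OF assms] unfolding R_generated_def by blast
qed

text \<open>
  Generation is local: larger elements never help to generate smaller ones, because a separating
  member may be filled up above \<open>x\<close> at will.
\<close>

lemma R_generated_below:
  assumes R: "R_variety \<R>" and A: "A \<subseteq> maximum_member \<R>" and x: "x \<in> R_generated \<R> A"
  shows "x \<in> R_generated \<R> {a \<in> A. a \<le> x}"
proof (rule ccontr)
  assume "x \<notin> R_generated \<R> {a \<in> A. a \<le> x}"
  then obtain S where S: "S \<in> \<R>" "{a \<in> A. a \<le> x} \<subseteq> S" "x \<notin> S"
    using not_in_R_generated_iff[OF R] by blast
  let ?T = "S \<union> {d \<in> maximum_member \<R>. x < d}"
  have "?T \<in> \<R>" by (rule R_variety_fill_above[OF R S(1)])
  moreover have "A \<subseteq> ?T" using A S(2) by (auto simp: not_less)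
  moreover have "x \<notin> ?T" using S(3) by simp
  ultimately have "x \<notin> R_generated \<R> A"
    using not_in_R_generated_iff[OF R] by blast
  with x show False by contradiction
qed

definition indispensable :: "nat set set \<Rightarrow> nat set \<Rightarrow> nat set" where
  "indispensable \<R> M = {x \<in> M. x \<notin> R_generated \<R> {m \<in> M. m < x}}"

lemma R_generated_indispensable:
  assumes "R_monoid \<R> M"
  shows "R_generated \<R> (indispensable \<R> M) = M"
proof
  show "R_generated \<R> (indispensable \<R> M) \<subseteq> M"
    using assms by (rule R_generated_subset) (auto simp: indispensable_def)
  show "M \<subseteq> R_generated \<R> (indispensable \<R> M)"
  proof
    fix x assume "x \<in> M"
    then show "x \<in> R_generated \<R> (indispensable \<R> M)"
    proof (induction x rule: less_induct)
      case (less x)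
      show ?case
      proof (cases "x \<in> indispensable \<R> M")
        case True
        then show ?thesis using subset_R_generated by blast
      next
        case False
        with less.prems have "x \<in> R_generated \<R> {m \<in> M. m < x}"
          by (simp add: indispensable_def)
        moreover have "{m \<in> M. m < x} \<subseteq> R_generated \<R> (indispensable \<R> M)"
          using less.IH by blast
        ultimately show ?thesis
          using R_generated_subset_R_generated by blast
      qed
    qed
  qed
qed

text \<open>
  By locality, generating \<open>x\<close> without using \<open>x\<close> itself would only use smaller elements of \<open>M\<close>.
\<close>

lemma indispensable_subset_generators:
  assumes R: "R_variety \<R>" and M: "R_monoid \<R> M" and gen: "R_generated \<R> A = M"
  shows "indispensable \<R> M \<subseteq> A"
proof (rule subsetI, rule ccontr)
  fix x assume x: "x \<in> indispensable \<R> M" and "x \<notin> A"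
  have "A \<subseteq> M" using gen subset_R_generated by blast
  with R_monoid_subset_maximum[OF R M] have "A \<subseteq> maximum_member \<R>" by blast
  moreover have "x \<in> R_generated \<R> A" using x gen by (simp add: indispensable_def)
  ultimately have "x \<in> R_generated \<R> {a \<in> A. a \<le> x}"
    by (rule R_generated_below[OF R])
  moreover have "{a \<in> A. a \<le> x} \<subseteq> {m \<in> M. m < x}"
    using \<open>A \<subseteq> M\<close> \<open>x \<notin> A\<close> by (auto simp: order_le_less)
  ultimately have "x \<in> R_generated \<R> {m \<in> M. m < x}"
    using R_generated_mono by blast
  with x show False by (simp add: indispensable_def)
qed

text \<open>
  A system of generators contained in all others is the only minimal one.
\<close>

lemma minimal_R_system_eq:
  assumes R: "R_variety \<R>" and M: "R_monoid \<R> M"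
  shows "minimal_R_system \<R> M = indispensable \<R> M"
  unfolding minimal_R_system_def
proof (rule the_equality)
  have "indispensable \<R> M \<subseteq> maximum_member \<R>"
    using R_monoid_subset_maximum[OF R M] by (auto simp: indispensable_def)
  then show "is_minimal_R_system \<R> M (indispensable \<R> M)"
    using R_generated_indispensable[OF M] indispensable_subset_generators[OF R M]
    unfolding is_minimal_R_system_def R_system_of_generators_def by blast
next
  fix A assume A: "is_minimal_R_system \<R> M A"
  then have "indispensable \<R> M \<subseteq> A"
    using indispensable_subset_generators[OF R M]
    unfolding is_minimal_R_system_def R_system_of_generators_def by blast
  with A R_generated_indispensable[OF M] show "A = indispensable \<R> M"
    unfolding is_minimal_R_system_def by blast
qed

theorem proposition3p9:
  fixes \<R> :: "nat set set" and M :: "nat set" and x :: nat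
  assumes "R_variety \<R>"
    and "R_monoid \<R> M"
    and "x \<in> M"
  shows "R_monoid \<R> (M - {x}) \<longleftrightarrow> x \<in> minimal_R_system \<R> M"
  unfolding minimal_R_system_eq[OF assms(1,2)]
proof
  assume "R_monoid \<R> (M - {x})"
  moreover have "{m \<in> M. m < x} \<subseteq> M - {x}" by blast
  ultimately have "R_generated \<R> {m \<in> M. m < x} \<subseteq> M - {x}"
    by (rule R_generated_subset)
  with assms(3) show "x \<in> indispensable \<R> M"
    by (auto simp: indispensable_def)
next
  assume "x \<in> indispensable \<R> M"
  then obtain S where S: "S \<in> \<R>" "{m \<in> M. m < x} \<subseteq> S" "x \<notin> S"
    using not_in_R_generated_iff[OF assms(1)] by (auto simp: indispensable_def)
  define T where "T = S \<union> {d \<in> maximum_member \<R>. x < d}"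
  have "T \<in> \<R>"
    unfolding T_def by (rule R_variety_fill_above[OF assms(1) S(1)])
  obtain \<F> where \<F>: "\<F> \<subseteq> \<R>" "M = \<Inter>\<F>"
    using assms(2) unfolding R_monoid_def by blast
  have "M - {x} \<subseteq> T"
  proof
    fix m assume m: "m \<in> M - {x}"
    then consider "m < x" | "x < m" by fastforce
    then show "m \<in> T"
      using m S(2) R_monoid_subset_maximum[OF assms(1,2)] unfolding T_def by cases auto
  qed
  moreover have "x \<notin> T" using S(3) by (simp add: T_def)
  ultimately have "M - {x} = \<Inter>(insert T \<F>)" using \<F>(2) by auto
  moreover have "R_monoid \<R> (\<Inter>(insert T \<F>))"
    using \<open>T \<in> \<R>\<close> \<F>(1) by (intro R_monoid_Inter[OF assms(1)]) auto
  ultimately show "R_monoid \<R> (M - {x})" by simp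
qed

end
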